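(* Let $P=F_1\oplus L_1+\cdots+F_k\oplus L_k$ be a poset on $[n]$, where each $F_i$ is a rooted forest and each $L_i$ is a ladder, $L_i=Q^i_1\oplus\cdots\oplus Q^i_{t_i}$ with each $Q^i_j$ an antichain of the form $\{a^i_j,b^i_j\}$ or $\{a^i_j\}$. Then the partition function for the promotion graph is $$Z_P=\prod_{i=1}^n x_{\preccurlyeq i}\ \prod_{Q^i_j:\ |Q^i_j|=2}\frac{x_{\preccurlyeq a^i_j\cup b^i_j}}{x_{\preccurlyeq a^i_j}+x_{\preccurlyeq b^i_j}},$$ where $x_{\preccurlyeq a^i_j\cup b^i_j}=\sum_{s\preccurlyeq a^i_j\text{ or }s\preccurlyeq b^i_j}x_s$.
   Context: The direct sum $P+Q$ is the disjoint union of $P$ and $Q$ with no relations between them; the ordinal sum $P\oplus Q$ is the disjoint union with the relations of $P$, of $Q$, and $x\prec y$ for all $x\in P$, $y\in Q$; $\oplus$ is performed before $+$. A rooted tree is a connected poset in which each element is covered by at most one element; a rooted forest is a direct sum of rooted trees. A ladder is an ordinal sum $Q_1\oplus\cdots\oplus Q_m$ of antichains of size 1 or 2. The $F_i$ and $L_i$ may be empty. A linear extension of $P$ is a word $\pi=\pi_1\cdots\pi_n$ listing each element of $P$ once such that $\pi_i\prec\pi_j$ implies $i<j$; $\mathcal L(P)$ is the set of them. The parameters $x_1,\dots,x_n$ are positive reals (the transition probabilities of the promotion Markov chain), and $x_{\preccurlyeq i}=\sum_{s\preccurlyeq i}x_s$. The stationary weight of $\pi\in\mathcal L(P)$ for the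 promotion Markov chain is $$w(\pi)=\prod_{i=1}^n\frac1{x_{\pi_1}+\cdots+x_{\pi_i}},$$ and the partition function $Z_P$ is the factor normalizing these weights, i.e. the one for which $\sum_{\pi\in\mathcal L(P)}Z_P\,w(\pi)=1$. *)

theory Defs
  imports Complex_Main "HOL-Library.Disjoint_Sets"
begin

text \<open>
  A poset is a reflexive order relation \<open>r\<close> with \<^term>\<open>Partial_order r\<close>; its ground set is
  \<^term>\<open>Field r\<close>, and \<open>(a, b) \<in> r\<close> means \<open>a \<preceq> b\<close>. The empty relation is the empty poset.
  Sums are internal: the summands live on disjoint subsets of one type.
\<close>

definition is_direct_sum :: "'i set \<Rightarrow> ('i \<Rightarrow> 'a rel) \<Rightarrow> 'a rel \<Rightarrow> bool" where
  "is_direct_sum I R r \<longleftrightarrow> disjoint_family_on (\<lambda>i. Field (R i)) I \<and> r = (\<Union>i\<in>I. R i)"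

text \<open>This is the ordinal sum only if \<^term>\<open>Field r \<inter> Field s = {}\<close>, which is required at each use.\<close>

definition ordinal_sum :: "'a rel \<Rightarrow> 'a rel \<Rightarrow> 'a rel" (infixr "\<oplus>\<^sub>o" 70) where
  "r \<oplus>\<^sub>o s = r \<union> s \<union> Field r \<times> Field s"

definition covered_by :: "'a rel \<Rightarrow> 'a \<Rightarrow> 'a \<Rightarrow> bool" where
  "covered_by r a b \<longleftrightarrow> (a, b) \<in> r \<and> a \<noteq> b \<and>
     (\<forall>c. (a, c) \<in> r \<and> (c, b) \<in> r \<longrightarrow> c = a \<or> c = b)"

definition connected_poset :: "'a rel \<Rightarrow> bool" where
  "connected_poset r \<longleftrightarrow> Field r \<noteq> {} \<and>
     (\<forall>a\<in>Field r. \<forall>b\<in>Field r. (a, b) \<in> (r \<union> r\<inverse>)\<^sup>*)"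

definition rooted_tree :: "'a rel \<Rightarrow> bool" where
  "rooted_tree r \<longleftrightarrow> Partial_order r \<and> finite (Field r) \<and> connected_poset r \<and>
     (\<forall>a b c. covered_by r a b \<and> covered_by r a c \<longrightarrow> b = c)"

definition rooted_forest :: "'a rel \<Rightarrow> bool" where
  "rooted_forest r \<longleftrightarrow>
     (\<exists>(m::nat) T. (\<forall>i\<in>{1..m}. rooted_tree (T i)) \<and> is_direct_sum {1..m} T r)"

text \<open>
  \<open>is_ladder t Q r\<close>: \<open>r\<close> is the ladder \<open>Q 1 \<oplus> \<dots> \<oplus> Q t\<close>. The antichain with ground set \<open>A\<close>
  is \<^term>\<open>Id_on A\<close>.
\<close>

definition is_ladder :: "nat \<Rightarrow> (nat \<Rightarrow> 'a set) \<Rightarrow> 'a rel \<Rightarrow> bool" where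
  "is_ladder t Q r \<longleftrightarrow>
     (\<forall>j\<in>{1..t}. card (Q j) = 1 \<or> card (Q j) = 2) \<and> disjoint_family_on Q {1..t} \<and>
     r = foldr (\<oplus>\<^sub>o) (map (\<lambda>j. Id_on (Q j)) [1..<Suc t]) {}"

definition linear_extensions :: "'a rel \<Rightarrow> 'a list set" where
  "linear_extensions r = {p. distinct p \<and> set p = Field r \<and>
     (\<forall>i<length p. \<forall>j<length p. (p ! i, p ! j) \<in> r \<and> p ! i \<noteq> p ! j \<longrightarrow> i < j)}"

definition stationary_weight :: "('a \<Rightarrow> real) \<Rightarrow> 'a list \<Rightarrow> real" where
  "stationary_weight x p = (\<Prod>i=1..length p. 1 / sum_list (map x (take i p)))"

definition partition_function :: "'a rel \<Rightarrow> ('a \<Rightarrow> real) \<Rightarrow> real" where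
  "partition_function r x =
     (THE Z. (\<Sum>p\<in>linear_extensions r. Z * stationary_weight x p) = 1)"

definition down_sum :: "'a rel \<Rightarrow> ('a \<Rightarrow> real) \<Rightarrow> 'a set \<Rightarrow> real" where
  "down_sum r x A = (\<Sum>s\<in>{s. \<exists>q\<in>A. (s, q) \<in> r}. x s)"

end

theory Submission
  imports Defs
begin

text \<open>
  Split the weights of the linear extensions of a down-set \<open>D\<close> by the last element \<open>m\<close>, which is
  a maximal element of \<open>D\<close>: their sum \<open>W D\<close> satisfies \<open>x(D) W(D) = (\<Sum>m. W (D - {m}))\<close>. The
  reciprocal \<open>G D\<close> of the claimed product satisfies the same recursion. Indeed,
  \<open>G (D - {m}) / G D\<close> is \<open>x\<^sub>\<preceq>\<^sub>m\<close> if \<open>m\<close> does not belong to a rung \<open>{a, b} \<subseteq> D\<close>, and the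
  contributions of \<open>a\<close> and \<open>b\<close> for a rung \<open>{a, b}\<close> at the top of \<open>D\<close> add up to the weight of the
  down-set generated by \<open>{a, b}\<close>; and the down-sets generated by the maximal singletons and the
  maximal rungs partition \<open>D\<close>, because incomparable elements with a common lower bound form a rung.
\<close>

section \<open>Linear extensions of down-sets\<close>

text \<open>Keeping \<open>r\<close> fixed and varying only \<open>D\<close> lets elements be
  deleted without restricting the relation. The \<open>sorted_wrt\<close> form splits along appended
  words.\<close>

definition linear_orders_on :: "'a rel \<Rightarrow> 'a set \<Rightarrow> 'a list set" where
  "linear_orders_on r D = {p. distinct p \<and> set p = D \<and> sorted_wrt (\<lambda>u v. (v, u) \<notin> r) p}"

lemma linear_extensions_eq: "linear_extensions r = linear_orders_on r (Field r)"
proof -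
  have "(\<forall>i<length p. \<forall>j<length p. (p ! i, p ! j) \<in> r \<and> p ! i \<noteq> p ! j \<longrightarrow> i < j) \<longleftrightarrow>
    sorted_wrt (\<lambda>u v. (v, u) \<notin> r) p" if "distinct p" for p
  proof
    assume A: "\<forall>i<length p. \<forall>j<length p. (p ! i, p ! j) \<in> r \<and> p ! i \<noteq> p ! j \<longrightarrow> i < j"
    show "sorted_wrt (\<lambda>u v. (v, u) \<notin> r) p"
      unfolding sorted_wrt_iff_nth_less
    proof (intro allI impI)
      fix i j assume "i < j" "j < length p"
      then show "(p ! j, p ! i) \<notin> r"
        using A[rule_format, of j i] that by (auto simp: nth_eq_iff_index_eq)
    qed
  next
    assume A: "sorted_wrt (\<lambda>u v. (v, u) \<notin> r) p"
    show "\<forall>i<length p. \<forall>j<length p. (p ! i, p ! j) \<in> r \<and> p ! i \<noteq> p ! j \<longrightarrow> i < j"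
      using A unfolding sorted_wrt_iff_nth_less by (metis linorder_neqE_nat)
  qed
  then show ?thesis
    unfolding linear_extensions_def linear_orders_on_def by blast
qed

lemma finite_linear_orders_on: "finite D \<Longrightarrow> finite (linear_orders_on r D)"
  by (rule finite_subset[OF _ finite_subset_distinct]) (auto simp: linear_orders_on_def)

lemma linear_orders_on_empty [simp]: "linear_orders_on r {} = {[]}"
  by (auto simp: linear_orders_on_def)

definition maximals :: "'a rel \<Rightarrow> 'a set \<Rightarrow> 'a set" where
  "maximals r D = {m \<in> D. \<forall>c\<in>D. (m, c) \<in> r \<longrightarrow> c = m}"

text \<open>The last entry of such a word has nothing of \<open>D\<close> strictly above it;
  conversely, appending a maximal element to a word on the rest creates no forbidden pair.\<close>

lemma linear_orders_on_snoc:
  assumes "D \<noteq> {}"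
  shows "linear_orders_on r D = (\<Union>m\<in>maximals r D. (\<lambda>p. p @ [m]) ` linear_orders_on r (D - {m}))"
proof (intro set_eqI iffI)
  fix p assume p: "p \<in> linear_orders_on r D"
  then have "p \<noteq> []" using assms by (auto simp: linear_orders_on_def)
  then obtain q m where "p = q @ [m]" by (metis append_butlast_last_id)
  with p have "q \<in> linear_orders_on r (D - {m})" "m \<in> maximals r D"
    by (auto simp: linear_orders_on_def maximals_def sorted_wrt_append)
  with \<open>p = q @ [m]\<close> show "p \<in> (\<Union>m\<in>maximals r D. (\<lambda>p. p @ [m]) ` linear_orders_on r (D - {m}))"
    by blast
qed (auto simp: linear_orders_on_def maximals_def sorted_wrt_append)

lemma stationary_weight_snoc:
  assumes "distinct (p @ [m])"
  shows "stationary_weight x (p @ [m]) = stationary_weight x p / sum x (insert m (set p))"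
proof -
  have "sum_list (map x (p @ [m])) = sum x (insert m (set p))"
    using sum_list_distinct_conv_sum_set[OF assms, of x] by simp
  then show ?thesis
    by (simp add: stationary_weight_def prod.nat_ivl_Suc')
qed

section \<open>Total weight and its recursion\<close>

definition weight_sum :: "'a rel \<Rightarrow> ('a \<Rightarrow> real) \<Rightarrow> 'a set \<Rightarrow> real" where
  "weight_sum r x D = (\<Sum>p\<in>linear_orders_on r D. stationary_weight x p)"

lemma weight_sum_empty: "weight_sum r x {} = 1"
  by (simp add: weight_sum_def stationary_weight_def)

text \<open>All words on \<open>D\<close> share the last factor, the reciprocal of
  \<open>sum x D\<close>; what remains is the weight of the word without its last letter.\<close>

lemma weight_sum_rec:
  assumes "finite D" "D \<noteq> {}"
  shows "weight_sum r x D = (\<Sum>m\<in>maximals r D. weight_sum r x (D - {m})) / sum x D"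
proof -
  have fin: "finite (maximals r D)" using assms by (simp add: maximals_def)
  have "weight_sum r x D =
    (\<Sum>m\<in>maximals r D. \<Sum>p\<in>(\<lambda>p. p @ [m]) ` linear_orders_on r (D - {m}). stationary_weight x p)"
    unfolding weight_sum_def linear_orders_on_snoc[OF assms(2)]
    by (rule sum.UNION_disjoint) (use fin assms finite_linear_orders_on in auto)
  also have "\<dots> = (\<Sum>m\<in>maximals r D. weight_sum r x (D - {m}) / sum x D)"
  proof (rule sum.cong[OF refl])
    fix m assume "m \<in> maximals r D"
    then have "insert m D = D" by (auto simp: maximals_def)
    then have "(\<Sum>p\<in>linear_orders_on r (D - {m}). stationary_weight x (p @ [m])) =
      (\<Sum>p\<in>linear_orders_on r (D - {m}). stationary_weight x p / sum x D)"
      by (intro sum.cong[OF refl], subst stationary_weight_snoc) (auto simp: linear_orders_on_def)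
    then show "(\<Sum>p\<in>(\<lambda>p. p @ [m]) ` linear_orders_on r (D - {m}). stationary_weight x p) =
        weight_sum r x (D - {m}) / sum x D"
      by (simp add: weight_sum_def sum.reindex inj_on_def sum_divide_distrib)
  qed
  finally show ?thesis by (simp add: sum_divide_distrib)
qed

text \<open>The defining equation is linear in \<open>Z\<close>, so a nonzero total weight gives
  exactly one solution and the \<open>THE\<close> is meaningful.\<close>

lemma partition_function_eq:
  assumes "weight_sum r x (Field r) \<noteq> 0"
  shows "partition_function r x = 1 / weight_sum r x (Field r)"
  unfolding partition_function_def linear_extensions_eq sum_distrib_left[symmetric]
    weight_sum_def[symmetric]
  using assms by (intro the_equality) (auto simp: field_simps)

section \<open>Forests with rungs\<close>

text \<open>\<open>R\<close> is the set of the two-element antichains of the ladders.\<close>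

locale rung_forest =
  fixes r :: "'a rel" and x :: "'a \<Rightarrow> real" and R :: "'a set set"
  assumes po: "Partial_order r"
    and fin: "finite (Field r)"
    and pos: "i \<in> Field r \<Longrightarrow> 0 < x i"
    and card_rung: "q \<in> R \<Longrightarrow> card q = 2"
    and rung_sub: "q \<in> R \<Longrightarrow> q \<subseteq> Field r"
    and rung_disjoint: "q \<in> R \<Longrightarrow> q' \<in> R \<Longrightarrow> m \<in> q \<Longrightarrow> m \<in> q' \<Longrightarrow> q = q'"
    and rung_above: "q \<in> R \<Longrightarrow> u \<in> q \<Longrightarrow> v \<in> q \<Longrightarrow> (u, c) \<in> r \<Longrightarrow> c \<noteq> u \<Longrightarrow> (v, c) \<in> r \<and> c \<noteq> v"
    and common_lower: "(c, u) \<in> r \<Longrightarrow> (c, v) \<in> r \<Longrightarrow> (u, v) \<in> r \<or> (v, u) \<in> r \<or> {u, v} \<in> R"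
begin

abbreviation d :: "'a set \<Rightarrow> real" where "d \<equiv> down_sum r x"

definition down :: "'a set \<Rightarrow> 'a set" where "down A = {s. \<exists>q\<in>A. (s, q) \<in> r}"

definition down_closed :: "'a set \<Rightarrow> bool" where
  "down_closed D \<longleftrightarrow> D \<subseteq> Field r \<and> (\<forall>s q. (s, q) \<in> r \<longrightarrow> q \<in> D \<longrightarrow> s \<in> D)"

text \<open>The down-sums \<open>d\<close> refer to all of \<open>r\<close>, so shrinking
  \<open>D\<close> changes only the two index sets. A rung with just one element in \<open>D\<close>
  contributes no rung factor.\<close>

definition G :: "'a set \<Rightarrow> real" where
  "G D = (\<Prod>i\<in>D. 1 / d {i}) * (\<Prod>q\<in>{q \<in> R. q \<subseteq> D}. (\<Sum>i\<in>q. d {i}) / d q)"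

text \<open>Blocks collect the elements whose contributions to the recursion are added together. An
  element whose rung is not contained in \<open>D\<close> is a block by itself.\<close>

definition block :: "'a set \<Rightarrow> 'a \<Rightarrow> 'a set" where
  "block D m = (if \<exists>q\<in>R. m \<in> q \<and> q \<subseteq> D then (THE q. q \<in> R \<and> m \<in> q) else {m})"

section \<open>Order axioms and positivity\<close>

lemma r_refl: "i \<in> Field r \<Longrightarrow> (i, i) \<in> r"
  using po by (auto simp: order_on_defs refl_on_def)

lemma r_antisym: "(u, v) \<in> r \<Longrightarrow> (v, u) \<in> r \<Longrightarrow> u = v"
  using po by (auto simp: order_on_defs antisym_def)

lemma r_trans: "(u, v) \<in> r \<Longrightarrow> (v, w) \<in> r \<Longrightarrow> (u, w) \<in> r"
  using po by (auto simp: order_on_defs trans_def)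

lemma d_eq: "d A = sum x (down A)"
  by (simp add: down_sum_def down_def)

lemma down_sub: "down A \<subseteq> Field r"
  by (auto simp: down_def FieldI1)

lemma d_pos: assumes "A \<subseteq> Field r" "A \<noteq> {}" shows "0 < d A"
proof -
  have "down A \<noteq> {}" using assms r_refl by (auto simp: down_def)
  then show ?thesis
    unfolding d_eq using down_sub[of A] by (intro sum_pos) (auto intro: finite_subset[OF _ fin] pos)
qed

lemma sum_d_pos: assumes "A \<subseteq> Field r" "A \<noteq> {}" shows "0 < (\<Sum>i\<in>A. d {i})"
  using assms by (intro sum_pos) (auto intro: finite_subset[OF _ fin] d_pos)

lemma finite_R: "finite R"
  by (rule finite_subset[of _ "Pow (Field r)"]) (use rung_sub fin in auto)

lemma rung_nonempty: "q \<in> R \<Longrightarrow> q \<noteq> {}"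
  using card_rung by fastforce

lemma G_pos: assumes "D \<subseteq> Field r" shows "0 < G D"
proof -
  have "0 < (\<Prod>i\<in>D. 1 / d {i})"
    by (rule prod_pos) (use assms d_pos in auto)
  moreover have "0 < (\<Prod>q\<in>{q \<in> R. q \<subseteq> D}. (\<Sum>i\<in>q. d {i}) / d q)"
  proof (rule prod_pos)
    fix q assume "q \<in> {q \<in> R. q \<subseteq> D}"
    then have "q \<subseteq> Field r" "q \<noteq> {}" using rung_sub rung_nonempty by auto
    then show "0 < (\<Sum>i\<in>q. d {i}) / d q" using d_pos sum_d_pos by (intro divide_pos_pos)
  qed
  ultimately show ?thesis unfolding G_def by (rule mult_pos_pos)
qed

text \<open>Rungs are disjoint, so the rung through \<open>m\<close> is unique and the
  \<open>THE\<close> in \<open>block\<close> can be replaced by a case distinction.\<close>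

lemma block_cases:
  obtains (rung) q where "q \<in> R" "m \<in> q" "q \<subseteq> D" "block D m = q"
    | (single) "\<not> (\<exists>q\<in>R. m \<in> q \<and> q \<subseteq> D)" "block D m = {m}"
proof (cases "\<exists>q\<in>R. m \<in> q \<and> q \<subseteq> D")
  case True
  then obtain q where q: "q \<in> R" "m \<in> q" "q \<subseteq> D" by blast
  then have "(THE q. q \<in> R \<and> m \<in> q) = q" using rung_disjoint by (intro the_equality) auto
  then show ?thesis using q True rung by (simp add: block_def)
next
  case False
  then have "block D m = {m}" unfolding block_def by (rule if_not_P)
  with False show ?thesis by (rule single)
qed

lemma mem_block: "m \<in> block D m"
  by (cases rule: block_cases[of m D]) auto

lemma block_eq: assumes "m' \<in> block D m" shows "block D m' = block D m"
proof (cases rule: block_cases[of m D])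
  case (rung q)
  with assms have q: "m' \<in> q" by simp
  show ?thesis
    by (cases rule: block_cases[of m' D]) (use q rung rung_disjoint in auto)
qed (use assms in auto)

lemma block_sub: "m \<in> D \<Longrightarrow> block D m \<subseteq> D"
  by (cases rule: block_cases[of m D]) auto

text \<open>Deleting \<open>m\<close> drops the factor \<open>1 / d {m}\<close> and the factor of
  the rung through \<open>m\<close>, if that rung lies in \<open>D\<close>. For a singleton block
  the second quotient is \<open>d {m} / d {m} = 1\<close>, so one formula covers both cases.\<close>

lemma G_remove:
  assumes D: "D \<subseteq> Field r" and m: "m \<in> D"
  shows "G (D - {m}) = G D * (d {m} * (d (block D m) / (\<Sum>i\<in>block D m. d {i})))"
proof -
  have finD: "finite D" using D fin finite_subset by auto
  have dm: "d {m} \<noteq> 0" using d_pos[of "{m}"] D m by auto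
  have 1: "(\<Prod>i\<in>D. 1 / d {i}) * d {m} = (\<Prod>i\<in>D - {m}. 1 / d {i})"
    using dm by (simp add: prod.remove[OF finD m])
  let ?f = "\<lambda>q. (\<Sum>i\<in>q. d {i}) / d q"
  have 2: "prod ?f {q \<in> R. q \<subseteq> D - {m}} =
      prod ?f {q \<in> R. q \<subseteq> D} * (d (block D m) / (\<Sum>i\<in>block D m. d {i}))"
  proof (cases rule: block_cases[of m D])
    case (rung q)
    \<comment> \<open>Every other rung avoids \<open>m\<close>, so \<open>q\<close> is the only one
      lost.\<close>
    have "{q \<in> R. q \<subseteq> D - {m}} = {q \<in> R. q \<subseteq> D} - {q}"
      using rung rung_disjoint by blast
    moreover have "prod ?f {q \<in> R. q \<subseteq> D} = ?f q * prod ?f ({q \<in> R. q \<subseteq> D} - {q})"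
      by (rule prod.remove) (use rung finite_R in auto)
    moreover have "d q > 0" "(\<Sum>i\<in>q. d {i}) > 0"
      using d_pos[of q] sum_d_pos[of q] rung rung_sub rung_nonempty by auto
    ultimately show ?thesis using rung by simp
  next
    case single
    have "{q \<in> R. q \<subseteq> D - {m}} = {q \<in> R. q \<subseteq> D}"
      using single by blast
    then show ?thesis using single dm by simp
  qed
  show ?thesis
    unfolding G_def 1[symmetric] 2 by (simp add: mult_ac)
qed

section \<open>Decomposition of a down-set by its maximal blocks\<close>

lemma maximal_above:
  assumes D: "D \<subseteq> Field r" and s: "s \<in> D"
  obtains m where "m \<in> maximals r D" "(s, m) \<in> r"
proof -
  let ?U = "{c \<in> D. (s, c) \<in> r}"
  have "finite ?U" using D fin finite_subset by fastforce
  moreover have "asymp_on ?U (\<lambda>u v. (u, v) \<in> r \<and> u \<noteq> v)"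
    by (rule asymp_onI) (use r_antisym in blast)
  moreover have "transp_on ?U (\<lambda>u v. (u, v) \<in> r \<and> u \<noteq> v)"
    by (rule transp_onI) (use r_antisym r_trans in blast)
  moreover have "?U \<noteq> {}" using s r_refl D by blast
  ultimately obtain m where m: "m \<in> ?U" and "\<forall>c\<in>?U. c \<noteq> m \<longrightarrow> \<not> ((m, c) \<in> r \<and> m \<noteq> c)"
    by (rule Finite_Set.bex_max_element[THEN bexE])
  \<comment> \<open>Anything in \<open>D\<close> above \<open>m\<close> is also above
    \<open>s\<close>, so maximality within \<open>?U\<close> is maximality within
    \<open>D\<close>.\<close>
  then have "c = m" if "c \<in> D" "(m, c) \<in> r" for c
    using that r_trans by blast
  then show ?thesis using that m by (auto simp: maximals_def)
qed

text \<open>By \<open>rung_above\<close>, an element of \<open>D\<close> strictly above one member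
  of a rung is strictly above the other as well.\<close>

lemma block_maximal:
  assumes "D \<subseteq> Field r" "m \<in> maximals r D"
  shows "block D m \<subseteq> maximals r D"
proof (cases rule: block_cases[of m D])
  case (rung q)
  have "v \<in> maximals r D" if "v \<in> q" for v
    using rung_above[OF rung(1) that rung(2)] rung that assms
    by (auto simp: maximals_def)
  then show ?thesis using rung by auto
qed (use assms in auto)

text \<open>A common element \<open>s\<close> lies below some \<open>u\<close> and \<open>v\<close>
  in the two blocks, and \<open>common_lower\<close> applies: comparable maximal elements are equal,
  and otherwise \<open>{u, v}\<close> is a rung inside \<open>D\<close>, hence one block.\<close>

lemma block_intersect:
  assumes D: "D \<subseteq> Field r" and m: "m \<in> maximals r D" "m' \<in> maximals r D"
    and s: "s \<in> down (block D m)" "s \<in> down (block D m')"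
  shows "block D m = block D m'"
proof -
  obtain u v where u: "u \<in> block D m" "(s, u) \<in> r" and v: "v \<in> block D m'" "(s, v) \<in> r"
    using s by (auto simp: down_def)
  have uv: "u \<in> maximals r D" "v \<in> maximals r D"
    using u v block_maximal[OF D] m by auto
  have "block D u = block D v"
    using common_lower[OF u(2) v(2)]
  proof (elim disjE)
    assume R: "{u, v} \<in> R"
    show ?thesis
    proof (cases rule: block_cases[of u D])
      case (rung q)
      then have "q = {u, v}" using rung_disjoint R by blast
      then show ?thesis using rung block_eq[of v D u] by auto
    next
      case single
      then show ?thesis using R uv by (auto simp: maximals_def)
    qed
  qed (use uv in \<open>auto simp: maximals_def\<close>)
  then show ?thesis using block_eq u v by metis
qed

text \<open>The quotient depends only on the block, so the terms of a block add up to its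
  \<open>d\<close>. The down-sets generated by the blocks partition \<open>D\<close>.\<close>

lemma sum_blocks:
  assumes D: "down_closed D"
  shows "(\<Sum>m\<in>maximals r D. d {m} * (d (block D m) / (\<Sum>i\<in>block D m. d {i}))) = sum x D"
proof -
  let ?M = "maximals r D"
  let ?B = "block D ` ?M"
  have sub: "D \<subseteq> Field r" using D by (simp add: down_closed_def)
  have finM: "finite ?M" using finite_subset[OF sub fin] by (simp add: maximals_def)
  have Msub: "?M \<subseteq> D" by (auto simp: maximals_def)
  have UB: "\<Union>?B = ?M" using block_maximal[OF sub] mem_block by blast
  have disjB: "\<forall>A\<in>?B. \<forall>B\<in>?B. A \<noteq> B \<longrightarrow> A \<inter> B = {}"
  proof (intro ballI impI)
    fix A B assume "A \<in> ?B" "B \<in> ?B" "A \<noteq> B"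
    then obtain m m' where m: "A = block D m" "B = block D m'" by blast
    show "A \<inter> B = {}"
    proof (rule ccontr)
      assume "A \<inter> B \<noteq> {}"
      then obtain u where "u \<in> block D m" "u \<in> block D m'" using m by blast
      then show False using block_eq[of u D m] block_eq[of u D m'] m \<open>A \<noteq> B\<close> by simp
    qed
  qed
  have finB: "\<forall>A\<in>?B. finite A"
  proof
    fix A assume "A \<in> ?B"
    then have "A \<subseteq> ?M" using UB by blast
    then show "finite A" using finM by (rule finite_subset)
  qed
  have Usub: "(\<Union>A\<in>?B. down A) = D"
  proof
    show "(\<Union>A\<in>?B. down A) \<subseteq> D"
    proof
      fix s assume "s \<in> (\<Union>A\<in>?B. down A)"
      then obtain m u where "m \<in> ?M" "u \<in> block D m" "(s, u) \<in> r"
        by (auto simp: down_def)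
      moreover from this have "u \<in> D" using block_sub[of m D] Msub by blast
      ultimately show "s \<in> D" using D by (auto simp: down_closed_def)
    qed
    show "D \<subseteq> (\<Union>A\<in>?B. down A)"
    proof
      fix s assume "s \<in> D"
      then obtain m where "m \<in> ?M" "(s, m) \<in> r" using maximal_above[OF sub] by blast
      then show "s \<in> (\<Union>A\<in>?B. down A)" using mem_block by (auto simp: down_def)
    qed
  qed
  have "(\<Sum>m\<in>?M. d {m} * (d (block D m) / (\<Sum>i\<in>block D m. d {i}))) =
     (\<Sum>A\<in>?B. \<Sum>m\<in>A. d {m} * (d (block D m) / (\<Sum>i\<in>block D m. d {i})))"
    using sum.Union_disjoint[OF finB disjB] UB by simp
  also have "\<dots> = (\<Sum>A\<in>?B. d A)"
  proof (rule sum.cong[OF refl])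
    fix A assume A: "A \<in> ?B"
    then have "block D m = A" if "m \<in> A" for m using that block_eq by auto
    then have "(\<Sum>m\<in>A. d {m} * (d (block D m) / (\<Sum>i\<in>block D m. d {i}))) =
      (\<Sum>m\<in>A. d {m} * (d A / (\<Sum>i\<in>A. d {i})))"
      by simp
    also have "\<dots> = (\<Sum>m\<in>A. d {m}) * (d A / (\<Sum>i\<in>A. d {i}))"
      by (rule sum_distrib_right[symmetric])
    also have "\<dots> = d A"
    proof -
      have "A \<subseteq> Field r" using A UB Msub sub by blast
      moreover have "A \<noteq> {}" using A mem_block by auto
      ultimately show ?thesis using sum_d_pos[of A] by simp
    qed
    finally show "(\<Sum>m\<in>A. d {m} * (d (block D m) / (\<Sum>i\<in>block D m. d {i}))) = d A" .
  qed
  \<comment> \<open>Distinct blocks generate disjoint down-sets, by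
    \<open>block_intersect\<close>.\<close>
  also have "\<dots> = sum x (\<Union>A\<in>?B. down A)"
    unfolding d_eq
    by (rule sum.UNION_disjoint[symmetric])
      (use finM finite_subset[OF down_sub fin] block_intersect[OF sub] in blast)+
  finally show ?thesis by (simp only: Usub)
qed

text \<open>Both sides satisfy the same recursion, and deleting a maximal element keeps a set
  down-closed, so induction over proper subsets applies.\<close>

lemma weight_sum_eq_G:
  assumes "down_closed D"
  shows "weight_sum r x D = G D"
proof -
  have "finite D" using assms fin finite_subset by (auto simp: down_closed_def)
  then show ?thesis using assms
  proof (induction D rule: finite_psubset_induct)
    case (psubset D)
    have sub: "D \<subseteq> Field r" using psubset.prems by (simp add: down_closed_def)
    show ?case
    proof (cases "D = {}")
      case True
      \<comment> \<open>Rungs are nonempty, so both products in \<open>G {}\<close> are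
        empty.\<close>
      have "{q \<in> R. q \<subseteq> {}} = {}" using rung_nonempty by auto
      then have "G {} = 1" unfolding G_def by (simp only: prod.empty mult_1)
      then show ?thesis using True by (simp add: weight_sum_empty)
    next
      case False
      have "0 < sum x D" using False sub psubset.hyps by (intro sum_pos) (auto intro: pos)
      have "weight_sum r x (D - {m}) =
          G D * (d {m} * (d (block D m) / (\<Sum>i\<in>block D m. d {i})))" if m: "m \<in> maximals r D" for m
      proof -
        have "m \<in> D" using m by (simp add: maximals_def)
        moreover have "down_closed (D - {m})"
          using m psubset.prems by (auto simp: maximals_def down_closed_def)
        ultimately show ?thesis using psubset.IH[of "D - {m}"] G_remove[OF sub] by force
      qed
      then have "(\<Sum>m\<in>maximals r D. weight_sum r x (D - {m})) = G D * sum x D"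
        unfolding sum_blocks[OF psubset.prems, symmetric] sum_distrib_left
        by (rule sum.cong[OF refl])
      then have "weight_sum r x D = G D * sum x D / sum x D"
        unfolding weight_sum_rec[OF psubset.hyps False] by (rule arg_cong)
      then show ?thesis using \<open>0 < sum x D\<close> by simp
    qed
  qed
qed

lemma partition_function_rung_forest:
  "partition_function r x =
    (\<Prod>i\<in>Field r. d {i}) * (\<Prod>q\<in>R. d q / (\<Sum>i\<in>q. d {i}))"
proof -
  have "down_closed (Field r)" by (auto simp: down_closed_def FieldI1)
  then have W: "weight_sum r x (Field r) = G (Field r)" by (rule weight_sum_eq_G)
  have R: "{q \<in> R. q \<subseteq> Field r} = R" using rung_sub by auto
  have "weight_sum r x (Field r) \<noteq> 0" using W G_pos[of "Field r"] by simp
  then have "partition_function r x = 1 / G (Field r)"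
    using W by (simp add: partition_function_eq)
  then show ?thesis
    by (simp add: G_def R prod_dividef)
qed

end

section \<open>Rooted forests and ladders\<close>

text \<open>Induction on the number of elements above \<open>c\<close>: unless \<open>c\<close> is
  \<open>u\<close> or \<open>v\<close>, its unique cover lies below both and can replace
  \<open>c\<close>.\<close>

lemma rooted_tree_chain:
  assumes T: "rooted_tree r" and "(c, u) \<in> r" "(c, v) \<in> r"
  shows "(u, v) \<in> r \<or> (v, u) \<in> r"
proof -
  have fin: "finite (Field r)" and po: "Partial_order r"
    and cov: "\<And>a b c. covered_by r a b \<Longrightarrow> covered_by r a c \<Longrightarrow> b = c"
    using T by (auto simp: rooted_tree_def)
  have antisym: "\<And>u v. (u, v) \<in> r \<Longrightarrow> (v, u) \<in> r \<Longrightarrow> u = v"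
    using po by (auto simp: order_on_defs antisym_def)
  have trans: "\<And>u v w. (u, v) \<in> r \<Longrightarrow> (v, w) \<in> r \<Longrightarrow> (u, w) \<in> r"
    using po by (auto simp: order_on_defs trans_def)
  have refl: "\<And>u v. (u, v) \<in> r \<Longrightarrow> (u, u) \<in> r \<and> (v, v) \<in> r"
    using po by (auto simp: order_on_defs refl_on_def intro: FieldI1 FieldI2)
  have up: "finite (r `` {c})" for c
    by (rule finite_subset[OF _ fin]) (auto intro: FieldI2)
  have psub: "r `` {c'} \<subset> r `` {c}" if "(c, c') \<in> r" "c \<noteq> c'" for c c'
    using that trans antisym refl by blast
  \<comment> \<open>A cover of \<open>c\<close> below \<open>u\<close> is found by shrinking the
    finite interval from \<open>c\<close> to \<open>u\<close>.\<close>
  have cover: "\<exists>c'. covered_by r c c' \<and> (c', u) \<in> r" if "(c, u) \<in> r" "c \<noteq> u" for c u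
    using that
  proof (induction "card (r `` {c} \<inter> r\<inverse> `` {u})" arbitrary: u rule: less_induct)
    case less
    show ?case
    proof (cases "covered_by r c u")
      case True then show ?thesis using refl less.prems by blast
    next
      case False
      then obtain e where e: "(c, e) \<in> r" "(e, u) \<in> r" "e \<noteq> c" "e \<noteq> u"
        using less.prems unfolding covered_by_def by blast
      have "r `` {c} \<inter> r\<inverse> `` {e} \<subset> r `` {c} \<inter> r\<inverse> `` {u}"
        using e trans antisym refl less.prems by blast
      then have "card (r `` {c} \<inter> r\<inverse> `` {e}) < card (r `` {c} \<inter> r\<inverse> `` {u})"
        using up by (intro psubset_card_mono) auto
      from less.hyps[OF this e(1)] e show ?thesis using trans by blast
    qed
  qed
  show ?thesis using assms(2,3)
  proof (induction "card (r `` {c})" arbitrary: c rule: less_induct)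
    case less
    show ?case
    proof (cases "c = u \<or> c = v")
      case True then show ?thesis using less.prems by auto
    next
      case False
      then obtain c' where c': "covered_by r c c'" "(c', u) \<in> r" "(c', v) \<in> r"
        using cover cov less.prems by metis
      then have "(c, c') \<in> r" "c \<noteq> c'" by (auto simp: covered_by_def)
      then have "card (r `` {c'}) < card (r `` {c})"
        using up psub by (intro psubset_card_mono) auto
      from less.hyps[OF this c'(2,3)] show ?thesis .
    qed
  qed
qed

text \<open>The fields are disjoint, so \<open>c\<close> fixes the summand that contains both
  pairs.\<close>

lemma direct_sum_common:
  assumes "is_direct_sum I S r" "(c, u) \<in> r" "(c, v) \<in> r"
  obtains i where "i \<in> I" "(c, u) \<in> S i" "(c, v) \<in> S i"
proof -
  obtain i j where ij: "i \<in> I" "j \<in> I" "(c, u) \<in> S i" "(c, v) \<in> S j"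
    using assms by (auto simp: is_direct_sum_def)
  then have "i = j" using assms(1) unfolding is_direct_sum_def disjoint_family_on_def
    by (metis FieldI1 disjoint_iff)
  then show ?thesis using that ij by blast
qed

lemma rooted_forest_chain:
  assumes "rooted_forest r" "(c, u) \<in> r" "(c, v) \<in> r"
  shows "(u, v) \<in> r \<or> (v, u) \<in> r"
proof -
  obtain m :: nat and T where T: "\<forall>i\<in>{1..m}. rooted_tree (T i)" "is_direct_sum {1..m} T r"
    using assms(1) by (auto simp: rooted_forest_def)
  obtain i where i: "i \<in> {1..m}" "(c, u) \<in> T i" "(c, v) \<in> T i"
    using direct_sum_common[OF T(2) assms(2,3)] .
  then have "(u, v) \<in> T i \<or> (v, u) \<in> T i" using T(1) rooted_tree_chain by metis
  then show ?thesis using T(2) i(1) by (auto simp: is_direct_sum_def)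
qed

section \<open>Explicit order of a ladder\<close>

lemma Field_ordinal_sum: "Field (r \<oplus>\<^sub>o s) = Field r \<union> Field s"
  by (auto simp: ordinal_sum_def Field_def)

text \<open>Stated for any strictly increasing index list, so that induction on the list can pass to
  its tail.\<close>

lemma foldr_ordinal_sum_antichains:
  fixes js :: "nat list"
  assumes "sorted_wrt (<) js"
  shows "Field (foldr (\<oplus>\<^sub>o) (map (\<lambda>j. Id_on (Q j)) js) {}) = (\<Union>j\<in>set js. Q j)"
    and "(u, v) \<in> foldr (\<oplus>\<^sub>o) (map (\<lambda>j. Id_on (Q j)) js) {} \<longleftrightarrow>
      (\<exists>i\<in>set js. \<exists>j\<in>set js. u \<in> Q i \<and> v \<in> Q j \<and> (i < j \<or> i = j \<and> u = v))"
proof -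
  have Field_Id_on: "Field (Id_on A) = A" for A :: "'a set" by (auto simp: Field_def)
  \<comment> \<open>The list is generalized here so that the formula can be used for the tail
    below.\<close>
  show F: "Field (foldr (\<oplus>\<^sub>o) (map (\<lambda>j. Id_on (Q j)) js) {}) = (\<Union>j\<in>set js. Q j)" for js
    by (induction js) (auto simp: Field_ordinal_sum Field_Id_on)
  show "(u, v) \<in> foldr (\<oplus>\<^sub>o) (map (\<lambda>j. Id_on (Q j)) js) {} \<longleftrightarrow>
      (\<exists>i\<in>set js. \<exists>j\<in>set js. u \<in> Q i \<and> v \<in> Q j \<and> (i < j \<or> i = j \<and> u = v))"
    using assms
  proof (induction js)
    case (Cons k js)
    let ?r = "foldr (\<oplus>\<^sub>o) (map (\<lambda>j. Id_on (Q j)) js) {}"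
    have IH: "(u, v) \<in> ?r \<longleftrightarrow>
      (\<exists>i\<in>set js. \<exists>j\<in>set js. u \<in> Q i \<and> v \<in> Q j \<and> (i < j \<or> i = j \<and> u = v))"
      using Cons by simp
    have k: "\<forall>j\<in>set js. k < j" using Cons.prems by simp
    have "(u, v) \<in> foldr (\<oplus>\<^sub>o) (map (\<lambda>j. Id_on (Q j)) (k # js)) {} \<longleftrightarrow>
      u \<in> Q k \<and> u = v \<or> (u, v) \<in> ?r \<or> u \<in> Q k \<and> (\<exists>j\<in>set js. v \<in> Q j)"
      using F[of js] by (auto simp: ordinal_sum_def Field_Id_on)
    then show ?case
      unfolding IH using k by (auto dest: less_asym)
  qed simp
qed

lemma
  assumes "is_ladder t Q r"
  shows Field_ladder: "Field r = (\<Union>j\<in>{1..t}. Q j)"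
    and ladder_iff: "(u, v) \<in> r \<longleftrightarrow>
      (\<exists>i\<in>{1..t}. \<exists>j\<in>{1..t}. u \<in> Q i \<and> v \<in> Q j \<and> (i < j \<or> i = j \<and> u = v))"
proof -
  have js: "set [1..<Suc t] = {1..t}" "sorted_wrt (<) [1..<Suc t]"
    by (auto simp del: upt_Suc)
  have r: "r = foldr (\<oplus>\<^sub>o) (map (\<lambda>j. Id_on (Q j)) [1..<Suc t]) {}"
    using assms by (simp add: is_ladder_def)
  show "Field r = (\<Union>j\<in>{1..t}. Q j)"
    and "(u, v) \<in> r \<longleftrightarrow>
      (\<exists>i\<in>{1..t}. \<exists>j\<in>{1..t}. u \<in> Q i \<and> v \<in> Q j \<and> (i < j \<or> i = j \<and> u = v))"
    using foldr_ordinal_sum_antichains[OF js(2), where Q = Q] unfolding r[symmetric] js(1) .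
qed

text \<open>It remains to verify the assumptions of \<open>rung_forest\<close> for \<open>P\<close>
  and to turn the product over rungs into a product over index pairs.\<close>

theorem theorem19:
  fixes n k :: nat
    and P :: "nat rel"
    and F L :: "nat \<Rightarrow> nat rel"
    and t :: "nat \<Rightarrow> nat"
    and Q :: "nat \<Rightarrow> nat \<Rightarrow> nat set"
    and a b :: "nat \<Rightarrow> nat \<Rightarrow> nat"
    and x :: "nat \<Rightarrow> real"
  assumes "Partial_order P" and "Field P = {1..n}"
    and "\<forall>i\<in>{1..n}. 0 < x i"
    and "\<forall>i\<in>{1..k}. rooted_forest (F i)"
    and "\<forall>i\<in>{1..k}. is_ladder (t i) (Q i) (L i)"
    and "\<forall>i\<in>{1..k}. \<forall>j\<in>{1..t i}. Q i j = {a i j, b i j} \<or> Q i j = {a i j}"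
    and "\<forall>i\<in>{1..k}. Field (F i) \<inter> Field (L i) = {}"
    and "is_direct_sum {1..k} (\<lambda>i. F i \<oplus>\<^sub>o L i) P"
  shows "partition_function P x =
    (\<Prod>i=1..n. down_sum P x {i}) *
    (\<Prod>(i, j)\<in>{(i, j). i \<in> {1..k} \<and> j \<in> {1..t i} \<and> card (Q i j) = 2}.
       down_sum P x {a i j, b i j} / (down_sum P x {a i j} + down_sum P x {b i j}))"
proof -
  define I where "I = {(i, j). i \<in> {1..k} \<and> j \<in> {1..t i} \<and> card (Q i j) = 2}"
  define R where "R = (\<lambda>(i, j). Q i j) ` I"
  have Pin: "(u, v) \<in> P" if "i \<in> {1..k}" "(u, v) \<in> F i \<oplus>\<^sub>o L i" for u v i
    using assms(8) that by (auto simp: is_direct_sum_def)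
  \<comment> \<open>An element of a ladder determines its summand, by disjointness of the direct
    sum, and its level, by disjointness of the antichains.\<close>
  have levels: "i = i'" "j = j'"
    if "i \<in> {1..k}" "j \<in> {1..t i}" "u \<in> Q i j" "i' \<in> {1..k}" "j' \<in> {1..t i'}" "u \<in> Q i' j'"
    for i j i' j' u
  proof -
    have "Field (L i) = (\<Union>j\<in>{1..t i}. Q i j)" "Field (L i') = (\<Union>j\<in>{1..t i'}. Q i' j)"
      using assms(5) that Field_ladder by blast+
    then have "u \<in> Field (F i \<oplus>\<^sub>o L i)" "u \<in> Field (F i' \<oplus>\<^sub>o L i')"
      unfolding Field_ordinal_sum using that by blast+
    then show *: "i = i'"
      using assms(8) that unfolding is_direct_sum_def disjoint_family_on_def by blast
    have "disjoint_family_on (Q i) {1..t i}" using assms(5) that by (auto simp: is_ladder_def)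
    then show "j = j'" using that * unfolding disjoint_family_on_def by blast
  qed
  have Qcases: "card (Q i j) = 1 \<or> card (Q i j) = 2" if "i \<in> {1..k}" "j \<in> {1..t i}" for i j
    using assms(5) that by (auto simp: is_ladder_def)
  interpret rung_forest P x R
  proof
    show "Partial_order P" by fact
    show "finite (Field P)" using assms(2) by simp
    show "0 < x i" if "i \<in> Field P" for i using assms(2,3) that by simp
    show "card q = 2" if "q \<in> R" for q using that by (auto simp: R_def I_def)
    show "q = q'" if "q \<in> R" "q' \<in> R" "m \<in> q" "m \<in> q'" for q q' m
      using that levels unfolding R_def I_def by blast
    show "q \<subseteq> Field P" if "q \<in> R" for q
    proof
      fix u assume "u \<in> q"
      then obtain i j where ij: "i \<in> {1..k}" "j \<in> {1..t i}" "u \<in> Q i j"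
        using \<open>q \<in> R\<close> by (auto simp: R_def I_def)
      have lad: "is_ladder (t i) (Q i) (L i)" using assms(5) ij by blast
      have "(u, u) \<in> L i" using ladder_iff[OF lad] ij by blast
      then have "(u, u) \<in> P" using Pin ij by (auto simp: ordinal_sum_def)
      then show "u \<in> Field P" by (rule FieldI1)
    qed
    \<comment> \<open>Whatever lies strictly above a ladder element is at a later level of the same
      ladder, hence strictly above the whole rung.\<close>
    show "(v, c) \<in> P \<and> c \<noteq> v"
      if "q \<in> R" and u: "u \<in> q" and v: "v \<in> q" and c: "(u, c) \<in> P" "c \<noteq> u" for q u v c
    proof -
      obtain i j where ij: "i \<in> {1..k}" "j \<in> {1..t i}" "q = Q i j"
        using \<open>q \<in> R\<close> by (auto simp: R_def I_def)
      have lad: "is_ladder (t i) (Q i) (L i)" using assms(5) ij by blast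
      have uu: "(u, u) \<in> L i" using ladder_iff[OF lad] ij u by blast
      have "(u, u) \<in> P" using uu Pin ij by (auto simp: ordinal_sum_def)
      then obtain i' where i': "i' \<in> {1..k}" "(u, c) \<in> F i' \<oplus>\<^sub>o L i'" "(u, u) \<in> F i' \<oplus>\<^sub>o L i'"
        using direct_sum_common[OF assms(8) c(1)] by blast
      have "u \<in> Field (F i \<oplus>\<^sub>o L i)" "u \<in> Field (F i' \<oplus>\<^sub>o L i')"
        using FieldI1[OF uu] FieldI1[OF i'(3)] by (simp_all add: Field_ordinal_sum)
      then have "i' = i"
        using assms(8) ij i' unfolding is_direct_sum_def disjoint_family_on_def by blast
      moreover have "u \<notin> Field (F i)" using assms(7) ij(1) FieldI1[OF uu] by blast
      ultimately have "(u, c) \<in> L i" using i' by (auto simp: ordinal_sum_def dest: FieldI1)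
      then obtain j' where j': "j' \<in> {1..t i}" "j < j'" "c \<in> Q i j'"
        using ladder_iff[OF lad, of u c] c levels(2)[OF ij(1,2)] ij u by blast
      then have "(v, c) \<in> L i" using ladder_iff[OF lad, of v c] ij v by blast
      then have "(v, c) \<in> P" using Pin ij by (auto simp: ordinal_sum_def)
      moreover have "c \<noteq> v" using levels(2)[OF ij(1,2) _ ij(1) j'(1)] j' v ij by blast
      ultimately show ?thesis by simp
    qed
    show "(u, v) \<in> P \<or> (v, u) \<in> P \<or> {u, v} \<in> R" if "(c, u) \<in> P" "(c, v) \<in> P" for c u v
    proof -
      obtain i where i: "i \<in> {1..k}" "(c, u) \<in> F i \<oplus>\<^sub>o L i" "(c, v) \<in> F i \<oplus>\<^sub>o L i"
        using direct_sum_common[OF assms(8) \<open>(c, u) \<in> P\<close> \<open>(c, v) \<in> P\<close>] .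
      have lad: "is_ladder (t i) (Q i) (L i)" using assms(5) i by blast
      have disj: "Field (F i) \<inter> Field (L i) = {}" using assms(7) i by blast
      have uv: "u \<in> Field (F i) \<union> Field (L i)" "v \<in> Field (F i) \<union> Field (L i)"
        using FieldI2[OF i(2)] FieldI2[OF i(3)] by (simp_all add: Field_ordinal_sum)
      consider "u \<in> Field (F i)" "v \<in> Field (F i)"
        | "u \<in> Field (F i)" "v \<in> Field (L i)" | "v \<in> Field (F i)" "u \<in> Field (L i)"
        | "u \<in> Field (L i)" "v \<in> Field (L i)"
        using uv by blast
      \<comment> \<open>Two forest elements above \<open>c\<close> are comparable by the chain
        property, a forest element is below every ladder element, and two ladder elements are
        comparable unless they form a rung.\<close>
      then show ?thesis
      proof cases
        case 1
        then have "u \<notin> Field (L i)" "v \<notin> Field (L i)" using disj by blast+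
        then have "(c, u) \<in> F i" "(c, v) \<in> F i"
          using i(2,3) by (auto simp: ordinal_sum_def dest: FieldI2)
        then have "(u, v) \<in> F i \<or> (v, u) \<in> F i"
          using rooted_forest_chain assms(4) i(1) by metis
        then show ?thesis using Pin i by (auto simp: ordinal_sum_def)
      next
        case 4
        then obtain j j' where j: "j \<in> {1..t i}" "j' \<in> {1..t i}" "u \<in> Q i j" "v \<in> Q i j'"
          unfolding Field_ladder[OF lad] by blast
        show ?thesis
        proof (cases "j = j' \<and> u \<noteq> v")
          case True
          \<comment> \<open>An infinite set has \<open>card\<close> 0, so cardinality 1 or 2 forces
            finiteness, which \<open>card_seteq\<close> needs.\<close>
          have "finite (Q i j)" using Qcases[OF i(1) j(1)] card.infinite by fastforce
          then have "{u, v} = Q i j"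
            using True j Qcases[OF i(1) j(1)] by (intro card_seteq) auto
          moreover have "card (Q i j) = 2" using calculation True by (metis card_2_iff)
          ultimately show ?thesis using i j by (auto simp: R_def I_def)
        next
          case False
          then have "(u, v) \<in> L i \<or> (v, u) \<in> L i"
            using j unfolding ladder_iff[OF lad] by (metis linorder_neqE_nat)
          then show ?thesis using Pin i by (auto simp: ordinal_sum_def)
        qed
      qed (use Pin i in \<open>auto simp: ordinal_sum_def\<close>)
    qed
  qed
  \<comment> \<open>Nonempty antichains at different index pairs are different sets, so the product
    over \<open>R\<close> can be reindexed by \<open>I\<close>.\<close>
  have inj: "inj_on (\<lambda>(i, j). Q i j) I"
  proof (rule inj_onI, clarify)
    fix i j i' j' assume ij: "(i, j) \<in> I" "(i', j') \<in> I" "Q i j = Q i' j'"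
    then have "Q i j \<noteq> {}" by (auto simp: I_def)
    then obtain u where "u \<in> Q i j" by blast
    with ij show "i = i' \<and> j = j'" using levels[of i j u i' j'] by (auto simp: I_def)
  qed
  have "(\<Prod>q\<in>R. down_sum P x q / (\<Sum>i\<in>q. down_sum P x {i})) =
    (\<Prod>(i, j)\<in>I. down_sum P x {a i j, b i j} / (down_sum P x {a i j} + down_sum P x {b i j}))"
    unfolding R_def prod.reindex[OF inj]
  proof (rule prod.cong[OF refl], clarify)
    fix i j assume ij: "(i, j) \<in> I"
    then have card: "card (Q i j) = 2" and ij: "i \<in> {1..k}" "j \<in> {1..t i}"
      by (simp_all add: I_def)
    have "Q i j = {a i j, b i j} \<or> Q i j = {a i j}" using assms(6) ij by blast
    moreover have "Q i j \<noteq> {a i j}" using card by force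
    ultimately have Q: "Q i j = {a i j, b i j}" by blast
    \<comment> \<open>Needed for the sum over the rung to have two separate terms.\<close>
    have "a i j \<noteq> b i j" using card unfolding Q by force
    with Q show "((\<lambda>q. down_sum P x q / (\<Sum>i\<in>q. down_sum P x {i})) \<circ> (\<lambda>(i, j). Q i j)) (i, j) =
        down_sum P x {a i j, b i j} / (down_sum P x {a i j} + down_sum P x {b i j})"
      by simp
  qed
  then show ?thesis
    unfolding partition_function_rung_forest assms(2) I_def by simp
qed

end
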